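(* For every integer $n\ge 1$ there exists an explicit bijection between the set of pairs of compositions of $n$ and the set of Dyck walks of length $2n-2$.
   Context: A composition of a positive integer $n$ is a finite sequence of positive integers with sum $n$. A pair of compositions of $n$ is an ordered pair $((a_1,\dots,a_k),(b_1,\dots,b_\ell))$ of compositions of $n$ (the numbers of parts $k$ and $\ell$ need not be equal). A Dyck walk of length $m$ is an unconstrained lattice path starting at $(0,0)$ consisting of $m$ steps, each being $\mathtt{u}=(1,1)$ or $\mathtt{d}=(1,-1)$; it may go below the $x$-axis and may end at any altitude. *)

theory Defs
  imports Main "HOL-Library.Product_Plus"
begin

definition compositions :: "nat \<Rightarrow> nat list set" where
  "compositions n = {a. (\<forall>x\<in>set a. 0 < x) \<and> sum_list a = n}"

definition composition_pairs :: "nat \<Rightarrow> (nat list \<times> nat list) set" where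
  "composition_pairs n = compositions n \<times> compositions n"

definition up :: "int \<times> int" where "up = (1, 1)"

definition down :: "int \<times> int" where "down = (1, - 1)"

text \<open>A walk is the list of all lattice points it visits, so a walk with \<open>m\<close> steps
  has \<open>m + 1\<close> points. The difference of points is taken componentwise.\<close>

definition dyck_walks :: "nat \<Rightarrow> (int \<times> int) list set" where
  "dyck_walks m = {p. length p = m + 1 \<and> p ! 0 = (0, 0) \<and>
     (\<forall>i<m. p ! Suc i - p ! i \<in> {up, down})}"

fun trace_from :: "int \<times> int \<Rightarrow> (int \<times> int) list \<Rightarrow> (int \<times> int) list" where
  "trace_from q [] = [q]"
| "trace_from q (s # ss) = q # trace_from (q + s) ss"

text \<open>Write \<open>n\<close> units in a row. A composition of \<open>n\<close> cuts the row at some of its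
  \<open>n - 1\<close> gaps. Read from left to right, an uncut gap gives the letter \<open>j\<close> and a cut
  gives the letter \<open>c\<close>.\<close>

fun gap_word :: "'a \<Rightarrow> 'a \<Rightarrow> nat list \<Rightarrow> 'a list" where
  "gap_word j c [] = []"
| "gap_word j c [x] = replicate (x - 1) j"
| "gap_word j c (x # y # xs) = replicate (x - 1) j @ c # gap_word j c (y # xs)"

text \<open>The explicit bijection: cuts of the first composition are up-steps and cuts of the
  second are down-steps, so a pair with \<open>k\<close> and \<open>l\<close> parts gives a walk that ends
  at altitude \<open>2 * (k - l)\<close>.\<close>

definition walk_of_pair :: "nat list \<times> nat list \<Rightarrow> (int \<times> int) list" where
  "walk_of_pair = (\<lambda>(a, b).
     trace_from (0, 0) (gap_word down up a @ gap_word up down b))"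

end

theory Submission
  imports Defs
begin

text \<open>The \<open>n - 1\<close> gaps of a composition of \<open>n\<close> can be cut independently of each other, so
  \<open>gap_word\<close> identifies compositions of \<open>n\<close> with binary words of length \<open>n - 1\<close>.
  Concatenation identifies pairs of such words with words of length \<open>2 * n - 2\<close>, and
  a walk is determined by its steps.\<close>

definition words :: "'a set \<Rightarrow> nat \<Rightarrow> 'a list set" where
  "words S m = {w. length w = m \<and> set w \<subseteq> S}"

text \<open>The length \<open>k\<close> of the first word is fixed, so the place of the split can be
  recovered from the concatenation.\<close>

lemma bij_betw_append_words:
  "bij_betw (\<lambda>(v, w). v @ w) (words S k \<times> words S l) (words S (k + l))"
proof (rule bij_betw_byWitness[where f' = "\<lambda>w. (take k w, drop k w)"])
  show "(\<lambda>w. (take k w, drop k w)) ` words S (k + l) \<subseteq> words S k \<times> words S l"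
    by (auto simp: words_def dest: in_set_takeD in_set_dropD)
qed (auto simp: words_def)

lemma nil_notin_compositions_Suc: "[] \<notin> compositions (Suc m)"
  by (simp add: compositions_def)

lemma Cons_in_compositions_iff:
  "x # xs \<in> compositions n \<longleftrightarrow> 0 < x \<and> x \<le> n \<and> xs \<in> compositions (n - x)"
  by (auto simp: compositions_def)

text \<open>\<open>gap_word\<close> recurses on whole parts; this equation and the next one peel off
  a single letter, which is the recursion that \<open>composition_of_word\<close> inverts. The side
  condition reflects that no cut follows the last part.\<close>

lemma gap_word_Suc_0_Cons: "xs \<noteq> [] \<Longrightarrow> gap_word j c (Suc 0 # xs) = c # gap_word j c xs"
  by (cases xs) auto

lemma gap_word_Suc_Suc_Cons:
  "gap_word j c (Suc (Suc x) # xs) = j # gap_word j c (Suc x # xs)"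
  by (cases xs) auto

text \<open>The inverse of \<open>gap_word\<close>: each letter puts one more unit in front, as a
  new part after a cut and otherwise glued to the first part. The word without letters still stands
  for one unit, since there is one gap fewer than units.\<close>

fun composition_of_word :: "'a \<Rightarrow> 'a list \<Rightarrow> nat list" where
  "composition_of_word c [] = [1]"
| "composition_of_word c (s # w) =
     (if s = c then 1 # composition_of_word c w
      else Suc (hd (composition_of_word c w)) # tl (composition_of_word c w))"

lemma composition_of_word_ne_Nil: "composition_of_word c w \<noteq> []"
  by (cases w) auto

lemma composition_of_word_in_compositions:
  "composition_of_word c w \<in> compositions (Suc (length w))"
proof (induction w)
  case Nil
  show ?case by (simp add: compositions_def)
next
  case (Cons s w)
  obtain y ys where "composition_of_word c w = y # ys"
    using composition_of_word_ne_Nil[of c w] by (cases "composition_of_word c w") auto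
  with Cons show ?case
    by (auto simp: Cons_in_compositions_iff)
qed

lemma gap_word_composition_of_word:
  "set w \<subseteq> {j, c} \<Longrightarrow> gap_word j c (composition_of_word c w) = w"
proof (induction w)
  case Nil
  show ?case by simp
next
  case (Cons s w)
  obtain y ys where y: "composition_of_word c w = y # ys"
    using composition_of_word_ne_Nil[of c w] by (cases "composition_of_word c w") auto
  \<comment> \<open>A positive head becomes \<open>Suc (Suc z)\<close> after gluing, which
    contributes a letter \<open>j\<close>; a zero head would become a part 1 and contribute
    none.\<close>
  then have "0 < y"
    using composition_of_word_in_compositions[of c w] by (auto simp: Cons_in_compositions_iff)
  then obtain z where "y = Suc z"
    by (cases y) auto
  with Cons y show ?case
    by (auto simp: gap_word_Suc_Suc_Cons)
qed

text \<open>Induction removes the first unit: a first part 1 is dropped together with the cut after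
  it, and a larger first part is shortened by one. As \<open>j\<close> differs from
  \<open>c\<close>, decoding never mistakes a join for a cut.\<close>

lemma gap_word_composition:
  assumes "a \<in> compositions (Suc m)" and "j \<noteq> c"
  shows "gap_word j c a \<in> words {j, c} m \<and> composition_of_word c (gap_word j c a) = a"
  using assms(1)
proof (induction m arbitrary: a)
  case 0
  then obtain x xs where a: "a = x # xs" and "x = 1" and xs: "xs \<in> compositions 0"
    by (cases a) (auto simp: nil_notin_compositions_Suc Cons_in_compositions_iff le_Suc_eq)
  moreover from xs have "xs = []"
    by (cases xs) (auto simp: Cons_in_compositions_iff)
  ultimately have "a = [1]"
    by simp
  then show ?case by (simp add: words_def)
next
  case (Suc m)
  then obtain x xs where a: "a = x # xs" and x: "0 < x"
    by (cases a) (auto simp: nil_notin_compositions_Suc Cons_in_compositions_iff)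
  show ?case
  proof (cases "x = 1")
    case True
    with Suc.prems a have xs: "xs \<in> compositions (Suc m)"
      by (simp add: Cons_in_compositions_iff)
    \<comment> \<open>At least one unit remains, so the first part really is followed by a
      cut.\<close>
    then have "xs \<noteq> []"
      using nil_notin_compositions_Suc by auto
    with True a Suc.IH[OF xs] show ?thesis
      by (simp add: gap_word_Suc_0_Cons words_def)
  next
    case False
    with x obtain y where y: "x = Suc (Suc y)"
      by (metis One_nat_def Suc_pred gr0_conv_Suc neq0_conv)
    with Suc.prems a have "Suc y # xs \<in> compositions (Suc m)"
      by (simp add: Cons_in_compositions_iff)
    with Suc.IH[OF this] a y assms(2) show ?thesis
      by (simp add: gap_word_Suc_Suc_Cons words_def)
  qed
qed

lemma bij_betw_gap_word:
  assumes "j \<noteq> c"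
  shows "bij_betw (gap_word j c) (compositions (Suc m)) (words {j, c} m)"
proof (rule bij_betw_byWitness[where f' = "composition_of_word c"])
  show "composition_of_word c ` words {j, c} m \<subseteq> compositions (Suc m)"
    using composition_of_word_in_compositions[of c] by (auto simp: words_def)
qed (use gap_word_composition[OF _ assms] in
      \<open>auto simp: words_def gap_word_composition_of_word\<close>)

lemma length_trace_from: "length (trace_from q ss) = Suc (length ss)"
  by (induction ss arbitrary: q) auto

lemma nth_trace_from:
  "i \<le> length ss \<Longrightarrow> trace_from q ss ! i = q + sum_list (take i ss)"
proof (induction ss arbitrary: q i)
  case (Cons s ss)
  then show ?case by (cases i) (auto simp: add.assoc)
qed auto

lemma step_trace_from:
  "i < length ss \<Longrightarrow> trace_from q ss ! Suc i - trace_from q ss ! i = ss ! i"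
  by (simp add: nth_trace_from take_Suc_conv_app_nth)

lemma bij_betw_trace_from:
  "bij_betw (trace_from (0, 0)) (words {up, down} m) (dyck_walks m)"
proof -
  \<comment> \<open>The inverse map takes consecutive differences; their partial sums
    telescope.\<close>
  define steps :: "(int \<times> int) list \<Rightarrow> (int \<times> int) list"
    where "steps = (\<lambda>p. map (\<lambda>i. p ! Suc i - p ! i) [0..<m])"
  have sum_steps: "sum_list (take i (steps p)) = p ! i - p ! 0" if "i \<le> m" for i p
    using that
  proof (induction i)
    case (Suc i)
    then show ?case by (simp add: steps_def take_Suc_conv_app_nth)
  qed simp
  show ?thesis
  proof (rule bij_betw_byWitness[where f' = steps])
    show "\<forall>ss\<in>words {up, down} m. steps (trace_from (0, 0) ss) = ss"
      by (auto simp: words_def steps_def step_trace_from intro!: nth_equalityI)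
    show "\<forall>p\<in>dyck_walks m. trace_from (0, 0) (steps p) = p"
    proof
      fix p assume p: "p \<in> dyck_walks m"
      have len: "length (steps p) = m"
        by (simp add: steps_def)
      show "trace_from (0, 0) (steps p) = p"
      proof (rule nth_equalityI)
        show "length (trace_from (0, 0) (steps p)) = length p"
          using p by (simp add: len length_trace_from dyck_walks_def)
      next
        fix i assume "i < length (trace_from (0, 0) (steps p))"
        then have "i \<le> m"
          by (simp add: len length_trace_from)
        \<comment> \<open>The differences fix a walk up to translation, and the common starting
          point removes that freedom. Rewriting \<open>(0, 0)\<close> to \<open>0\<close> makes the
          neutral element visible to the simplifier.\<close>
        then show "trace_from (0, 0) (steps p) ! i = p ! i"
          using p by (simp add: len nth_trace_from sum_steps dyck_walks_def flip: zero_prod_def)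
      qed
    qed
    show "trace_from (0, 0) ` words {up, down} m \<subseteq> dyck_walks m"
    proof
      fix p assume "p \<in> trace_from (0, 0) ` words {up, down} m"
      then obtain ss where ss: "length ss = m" "set ss \<subseteq> {up, down}"
        and p: "p = trace_from (0, 0) ss"
        by (auto simp: words_def)
      then have "ss ! i \<in> {up, down}" if "i < m" for i
        using that nth_mem by blast
      with ss(1) show "p \<in> dyck_walks m"
        unfolding p dyck_walks_def
        by (auto simp: length_trace_from step_trace_from nth_trace_from[where i = 0]
            simp flip: zero_prod_def)
    qed
    show "steps ` dyck_walks m \<subseteq> words {up, down} m"
      by (fastforce simp: dyck_walks_def words_def steps_def)
  qed
qed

theorem proposition2p1:
  fixes n :: nat
  assumes "n \<ge> 1"
  shows "bij_betw walk_of_pair (composition_pairs n) (dyck_walks (2 * n - 2))"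
proof -
  obtain m where n: "n = Suc m"
    using assms by (cases n) auto
  have "up \<noteq> down"
    by (simp add: up_def down_def)
  \<comment> \<open>The two codings exchange the roles of the letters, but both use the same
    alphabet, so their words can be concatenated.\<close>
  then have "bij_betw (gap_word down up) (compositions n) (words {up, down} m)"
    and "bij_betw (gap_word up down) (compositions n) (words {up, down} m)"
    using bij_betw_gap_word[of down up m] bij_betw_gap_word[of up down m]
    by (simp_all add: n insert_commute)
  then have "bij_betw (map_prod (gap_word down up) (gap_word up down))
      (composition_pairs n) (words {up, down} m \<times> words {up, down} m)"
    unfolding composition_pairs_def by (rule bij_betw_map_prod)
  \<comment> \<open>Encode both compositions, join the two words of length \<open>m\<close>, and
    trace the result; the total length \<open>m + m\<close> is \<open>2 * n - 2\<close>.\<close>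
  from bij_betw_trans[OF bij_betw_trans[OF this bij_betw_append_words] bij_betw_trace_from]
  have "bij_betw (trace_from (0, 0) \<circ> ((\<lambda>(v, w). v @ w) \<circ> map_prod (gap_word down up) (gap_word up down)))
      (composition_pairs n) (dyck_walks (m + m))" .
  moreover have "walk_of_pair =
      trace_from (0, 0) \<circ> ((\<lambda>(v, w). v @ w) \<circ> map_prod (gap_word down up) (gap_word up down))"
    by (auto simp: walk_of_pair_def)
  ultimately show ?thesis
    by (simp add: n mult_2)
qed

end
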